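(* Let $\widehat{X}$ be a sandpile graph whose sink has no outgoing edges. If $\mathcal{S}(0)=\{\text{sink}\}$, then $G_0=\{0\}$. Otherwise, $G_0$ is equal to the sandpile group of $\mathcal{S}(0)$, viewed as a subgroup of $\mathcal{M}(\widehat{X})$ via the natural inclusion.
   Context: A sandpile graph $\widehat{X}$ is a finite weakly connected directed multigraph (loops and multiple edges allowed) with a distinguished vertex, the sink, reachable by a directed path from every vertex; the set $V$ of non-sink vertices is nonempty, and $X$ is the digraph obtained by deleting the sink (with edge set $E$). A configuration assigns a nonnegative integer number of grains to each non-sink vertex; it is stable if every $v$ holds fewer than $\deg^{+}(v)$ (out-degree) grains. Toppling an unstable vertex sends one grain along each of its out-edges (grains at the sink vanish; the sink never topples); every configuration has a unique stabilization. $\mathcal{M}(\widehat X)$ is the set of stable configurations with $a\oplus b$ = stabilization of $a+b$, a commutative monoid with identity $0$ (the empty configuration); the sandpile group is its minimal ideal (a group, consisting of the recurrent elements, i.e., those accessible from every element, where $a$ is accessible from $b$ if $b\oplus x=a$ for some $x$). For an idempotent $e$, $G_e$ is the unique maximal subgroup of $\mathcal M(\widehat X)$ with identity $e$. The support $\operatorname{supp}(m)$ is the set of vertices holding at least one grain. A cycle is a directed closed path of length $\ge1$ in $X$. For $W\subseteq V$, $\operatorname{cl}(W)$ is the set of $z\in V$ reachable by a directed path (possibly trivial) in $X$ from some $w\in W$. A set $W\subseteq V$ is strongly connected if each of its vertices reaches every other by a path in $X$; a strongly connected component is a maximal such set; it is cyclic if it contains a cycle. A vertex is acyclic if it lies on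 no cycle. For an idempotent $e$, $A(e)$ is the set of acyclic vertices $v\in V$ with $v\notin\operatorname{cl}(\operatorname{supp}(e))$ such that every cyclic strongly connected component reachable from $v$ by a path in $X$ intersects $\operatorname{supp}(e)$. $\mathcal{S}(e)$ is the subgraph of $\widehat X$ induced on $\operatorname{cl}(\operatorname{supp}(e))\cup A(e)\cup\{\text{sink}\}$ (with sink the same sink), whose edges are those of $\widehat X$ with tail in this vertex set. Sandpile configurations on such a subgraph are identified with configurations of $\widehat X$ that vanish outside its non-sink vertices (the natural inclusion), making its sandpile monoid and group subsets of $\mathcal M(\widehat X)$. *)

theory Defs
  imports "HOL-Algebra.Group" "Graph_Theory.Arc_Walk" "Graph_Theory.Digraph_Component"
begin

definition sandpile_graph :: "('v, 'e) pre_digraph \<Rightarrow> 'v \<Rightarrow> bool" where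
  "sandpile_graph G s \<longleftrightarrow>
     fin_digraph G \<and> connected G \<and> s \<in> verts G \<and> verts G - {s} \<noteq> {} \<and>
     (\<forall>v\<in>verts G. v \<rightarrow>\<^sup>*\<^bsub>G\<^esub> s)"

text \<open>A configuration is a function on the whole vertex type that vanishes off the non-sink
  vertices. Hence, for a subgraph with the same sink, the natural inclusion of configurations
  (extension by zero) is the identity on functions.\<close>

definition config :: "('v, 'e) pre_digraph \<Rightarrow> 'v \<Rightarrow> ('v \<Rightarrow> nat) \<Rightarrow> bool" where
  "config G s c \<longleftrightarrow> (\<forall>v. v \<notin> verts G - {s} \<longrightarrow> c v = 0)"

definition stable :: "('v, 'e) pre_digraph \<Rightarrow> 'v \<Rightarrow> ('v \<Rightarrow> nat) \<Rightarrow> bool" where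
  "stable G s c \<longleftrightarrow> config G s c \<and> (\<forall>v\<in>verts G - {s}. c v < out_degree G v)"

definition topple :: "('v, 'e) pre_digraph \<Rightarrow> 'v \<Rightarrow> 'v \<Rightarrow> ('v \<Rightarrow> nat) \<Rightarrow> 'v \<Rightarrow> nat" where
  "topple G s v c = (\<lambda>w. if w \<in> verts G - {s}
     then c w - (if w = v then out_degree G v else 0) + card (out_arcs G v \<inter> in_arcs G w)
     else 0)"

definition topples :: "('v, 'e) pre_digraph \<Rightarrow> 'v \<Rightarrow> ('v \<Rightarrow> nat) \<Rightarrow> ('v \<Rightarrow> nat) \<Rightarrow> bool" where
  "topples G s c c' \<longleftrightarrow> (\<exists>v\<in>verts G - {s}. out_degree G v \<le> c v \<and> c' = topple G s v c)"

definition stabilization :: "('v, 'e) pre_digraph \<Rightarrow> 'v \<Rightarrow> ('v \<Rightarrow> nat) \<Rightarrow> 'v \<Rightarrow> nat" where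
  "stabilization G s c = (THE c'. (topples G s)\<^sup>*\<^sup>* c c' \<and> stable G s c')"

definition sandpile_monoid :: "('v, 'e) pre_digraph \<Rightarrow> 'v \<Rightarrow> ('v \<Rightarrow> nat) monoid" where
  "sandpile_monoid G s =
     \<lparr> carrier = {c. stable G s c},
       monoid.mult = (\<lambda>a b. stabilization G s (\<lambda>v. a v + b v)),
       one = (\<lambda>_. 0) \<rparr>"

definition monoid_ideal :: "('a, 'b) monoid_scheme \<Rightarrow> 'a set \<Rightarrow> bool" where
  "monoid_ideal M I \<longleftrightarrow> I \<noteq> {} \<and> I \<subseteq> carrier M \<and>
     (\<forall>x\<in>I. \<forall>a\<in>carrier M. a \<otimes>\<^bsub>M\<^esub> x \<in> I \<and> x \<otimes>\<^bsub>M\<^esub> a \<in> I)"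

definition minimal_ideal :: "('a, 'b) monoid_scheme \<Rightarrow> 'a set" where
  "minimal_ideal M =
     (THE I. monoid_ideal M I \<and> (\<forall>J. monoid_ideal M J \<and> J \<subseteq> I \<longrightarrow> J = I))"

definition sandpile_group :: "('v, 'e) pre_digraph \<Rightarrow> 'v \<Rightarrow> ('v \<Rightarrow> nat) set" where
  "sandpile_group G s = minimal_ideal (sandpile_monoid G s)"

text \<open>Subgroups of a monoid in the sense of semigroup theory: the identity \<open>e\<close> may be any
  idempotent of \<open>M\<close>.\<close>

definition subgroup_at :: "('a, 'b) monoid_scheme \<Rightarrow> 'a \<Rightarrow> 'a set \<Rightarrow> bool" where
  "subgroup_at M e H \<longleftrightarrow> H \<subseteq> carrier M \<and> group (M\<lparr>carrier := H, one := e\<rparr>)"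

definition maximal_subgroup :: "('a, 'b) monoid_scheme \<Rightarrow> 'a \<Rightarrow> 'a set" where
  "maximal_subgroup M e =
     (THE H. subgroup_at M e H \<and> (\<forall>K. subgroup_at M e K \<and> H \<subseteq> K \<longrightarrow> K = H))"

text \<open>The vertices of a closed walk are exactly the tails of its arcs. A loop is a cycle.\<close>

definition is_cycle :: "('v, 'e) pre_digraph \<Rightarrow> 'e list \<Rightarrow> bool" where
  "is_cycle X p \<longleftrightarrow> p \<noteq> [] \<and> (\<exists>u. pre_digraph.awalk X u p u)"

definition acyclic_vertex :: "('v, 'e) pre_digraph \<Rightarrow> 'v \<Rightarrow> bool" where
  "acyclic_vertex X v \<longleftrightarrow> v \<in> verts X \<and> \<not> (\<exists>p. is_cycle X p \<and> v \<in> tail X ` set p)"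

definition strongly_connected_set :: "('v, 'e) pre_digraph \<Rightarrow> 'v set \<Rightarrow> bool" where
  "strongly_connected_set X W \<longleftrightarrow> W \<subseteq> verts X \<and> (\<forall>u\<in>W. \<forall>v\<in>W. u \<rightarrow>\<^sup>*\<^bsub>X\<^esub> v)"

definition strong_component :: "('v, 'e) pre_digraph \<Rightarrow> 'v set \<Rightarrow> bool" where
  "strong_component X W \<longleftrightarrow> strongly_connected_set X W \<and>
     (\<forall>W'. strongly_connected_set X W' \<and> W \<subseteq> W' \<longrightarrow> W' = W)"

definition cyclic_set :: "('v, 'e) pre_digraph \<Rightarrow> 'v set \<Rightarrow> bool" where
  "cyclic_set X W \<longleftrightarrow> (\<exists>p. is_cycle X p \<and> tail X ` set p \<subseteq> W)"

definition cl :: "('v, 'e) pre_digraph \<Rightarrow> 'v set \<Rightarrow> 'v set" where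
  "cl X W = {z \<in> verts X. \<exists>w\<in>W. w \<rightarrow>\<^sup>*\<^bsub>X\<^esub> z}"

definition supp :: "('v \<Rightarrow> nat) \<Rightarrow> 'v set" where
  "supp m = {v. m v \<ge> 1}"

definition A_set :: "('v, 'e) pre_digraph \<Rightarrow> ('v \<Rightarrow> nat) \<Rightarrow> 'v set" where
  "A_set X e = {v \<in> verts X. acyclic_vertex X v \<and> v \<notin> cl X (supp e) \<and>
     (\<forall>W. strong_component X W \<and> cyclic_set X W \<and> (\<exists>w\<in>W. v \<rightarrow>\<^sup>*\<^bsub>X\<^esub> w) \<longrightarrow> W \<inter> supp e \<noteq> {})}"

definition S_verts :: "('v, 'e) pre_digraph \<Rightarrow> 'v \<Rightarrow> ('v \<Rightarrow> nat) \<Rightarrow> 'v set" where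
  "S_verts G s e =
     (let X = pre_digraph.del_vert G s in cl X (supp e) \<union> A_set X e \<union> {s})"

definition S_graph :: "('v, 'e) pre_digraph \<Rightarrow> 'v \<Rightarrow> ('v \<Rightarrow> nat) \<Rightarrow> ('v, 'e) pre_digraph" where
  "S_graph G s e = G \<restriction> S_verts G s e"

text \<open>If the sink has no outgoing edges, the heads of the edges leaving the vertex set lie in it
  again, so the induced subgraph keeps every edge with tail in the set, and stabilization in the
  subgraph agrees with stabilization in the whole graph.\<close>

lemma S_verts_closed:
  assumes wf: "wf_digraph G" and sink: "out_arcs G s = {}"
    and a: "a \<in> arcs G" "tail G a \<in> S_verts G s e"
  shows "head G a \<in> S_verts G s e"
proof (cases "head G a = s")
  case True
  then show ?thesis by (simp add: S_verts_def Let_def)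
next
  case False
  interpret G: wf_digraph G by (fact wf)
  define X where "X = pre_digraph.del_vert G s"
  interpret X: wf_digraph X unfolding X_def by (rule G.wf_digraph_del_vert)
  let ?t = "tail G a" and ?h = "head G a"
  have t: "?t \<noteq> s" using sink a by (auto simp: out_arcs_def)
  have aX: "a \<in> arcs X" "tail X a = ?t" "head X a = ?h"
    using a t False by (auto simp: X_def G.del_vert_simps)
  then have th: "?t \<rightarrow>\<^bsub>X\<^esub> ?h" by (metis X.dominatesI arc_to_ends_def)
  have hX: "?h \<in> verts X" using th X.adj_in_verts by blast
  have "?t \<in> cl X (supp e) \<union> A_set X e" using a t by (simp add: S_verts_def X_def Let_def)
  then have "?h \<in> cl X (supp e) \<union> A_set X e"
  proof
    assume "?t \<in> cl X (supp e)"
    then show ?thesis using th hX by (auto simp: cl_def intro: X.reachable_adj_trans)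
  next
    assume A: "?t \<in> A_set X e"
    have reach: "W \<inter> supp e \<noteq> {}"
      if "strong_component X W" "cyclic_set X W" "w \<in> W" "?h \<rightarrow>\<^sup>*\<^bsub>X\<^esub> w" for W w
      using A that th X.adj_reachable_trans[of ?t ?h w] unfolding A_set_def by blast
    show ?thesis
    proof (cases "acyclic_vertex X ?h")
      case True
      then show ?thesis using reach hX by (auto simp: A_set_def)
    next
      case False
      then obtain p where p: "is_cycle X p" "?h \<in> tail X ` set p"
        using hX by (auto simp: acyclic_vertex_def)
      then obtain u where u: "X.awalk u p u" by (auto simp: is_cycle_def)
      define W where "W = {v. ?h \<rightarrow>\<^sup>*\<^bsub>X\<^esub> v \<and> v \<rightarrow>\<^sup>*\<^bsub>X\<^esub> ?h}"
      have hW: "?h \<in> W" using hX by (simp add: W_def)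
      have "strongly_connected_set X W"
        unfolding strongly_connected_set_def W_def
        using X.reachable_trans X.reachable_in_verts(2) by blast
      moreover have "W' = W" if "strongly_connected_set X W'" "W \<subseteq> W'" for W'
        using that hW unfolding strongly_connected_set_def W_def by blast
      ultimately have "strong_component X W" unfolding strong_component_def by blast
      moreover have "cyclic_set X W"
      proof -
        have vs: "w \<in> set (X.awalk_verts u p)" if "w \<in> tail X ` set p" for w
          using that by (auto simp: X.awalk_verts_conv)
        have "w \<rightarrow>\<^sup>*\<^bsub>X\<^esub> w'" if "w \<in> tail X ` set p" "w' \<in> tail X ` set p" for w w'
          using X.awalk_verts_reachable_to[OF u vs[OF that(1)]]
            X.awalk_verts_reachable_from[OF u vs[OF that(2)]] X.reachable_trans by blast
        then have "tail X ` set p \<subseteq> W" using p(2) unfolding W_def by blast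
        then show ?thesis using p(1) unfolding cyclic_set_def by blast
      qed
      ultimately obtain v where v: "v \<in> W" "v \<in> supp e" using reach hW W_def by blast
      then show ?thesis using hX by (auto simp: cl_def W_def)
    qed
  qed
  then show ?thesis by (simp add: S_verts_def X_def Let_def)
qed

lemma arcs_S_graph:
  assumes "wf_digraph G" "out_arcs G s = {}"
  shows "arcs (S_graph G s e) = {a \<in> arcs G. tail G a \<in> S_verts G s e}"
  using S_verts_closed[OF assms] by (auto simp: S_graph_def)

lemma S_verts_subset: "s \<in> verts G \<Longrightarrow> S_verts G s e \<subseteq> verts G"
  by (auto simp: S_verts_def Let_def cl_def A_set_def pre_digraph.del_vert_def)

lemma config_topple: "config G s (topple G s v c)"
  by (auto simp: config_def topple_def)

lemma out_degree_pos:
  assumes "sandpile_graph G s" "v \<in> verts G - {s}"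
  shows "0 < out_degree G v"
proof -
  interpret fin_digraph G using assms by (simp add: sandpile_graph_def)
  have "v \<rightarrow>\<^sup>*\<^bsub>G\<^esub> s" "v \<noteq> s" using assms by (auto simp: sandpile_graph_def)
  then obtain w where "v \<rightarrow>\<^bsub>G\<^esub> w" by (blast elim: converse_reachable_cases)
  then obtain a where "a \<in> out_arcs G v" by auto
  then show ?thesis unfolding out_degree_def using finite_out_arcs by (auto simp: card_gt_0_iff)
qed

lemma stabilization_S_graph:
  assumes G: "sandpile_graph G s" and sink: "out_arcs G s = {}" and c: "config (S_graph G s e) s c"
  shows "stabilization (S_graph G s e) s c = stabilization G s c"
proof -
  interpret fin_digraph G using G by (simp add: sandpile_graph_def)
  let ?S = "S_graph G s e"
  have sG: "s \<in> verts G" using G by (simp add: sandpile_graph_def)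
  have vS: "verts ?S \<subseteq> verts G" using S_verts_subset[OF sG] by (simp add: S_graph_def)
  have th: "tail ?S = tail G" "head ?S = head G" by (simp_all add: S_graph_def)
  have arcs: "arcs ?S = {a \<in> arcs G. tail G a \<in> verts ?S}"
    using arcs_S_graph[OF wf_digraph sink] by (simp add: S_graph_def)
  have closed: "head G a \<in> verts ?S" if "a \<in> arcs G" "tail G a \<in> verts ?S" for a
    using S_verts_closed[OF wf_digraph sink] that by (simp add: S_graph_def)
  have out: "out_arcs ?S v = out_arcs G v" if "v \<in> verts ?S" for v
    using that th arcs by (auto simp: out_arcs_def)
  have deg: "out_degree ?S v = out_degree G v" if "v \<in> verts ?S" for v
    using out[OF that] by (simp add: out_degree_def)
  have btw: "out_arcs ?S v \<inter> in_arcs ?S w = out_arcs G v \<inter> in_arcs G w" if "v \<in> verts ?S" for v w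
    using that th arcs by (auto simp: out_arcs_def in_arcs_def)
  have top: "topple ?S s v d = topple G s v d" if "v \<in> verts ?S" "config ?S s d" for v d
  proof
    fix w
    show "topple ?S s v d w = topple G s v d w"
    proof (cases "w \<in> verts ?S - {s}")
      case True
      then show ?thesis using vS that(1) deg btw by (auto simp: topple_def)
    next
      case False
      have "out_arcs G v \<inter> in_arcs G w = {}" if "w \<noteq> s"
        using False that closed \<open>v \<in> verts ?S\<close> by auto
      then show ?thesis using False that by (auto simp: topple_def config_def)
    qed
  qed
  have eq: "topples ?S s d d' \<longleftrightarrow> topples G s d d'" if d: "config ?S s d" for d d'
  proof
    assume "topples ?S s d d'"
    then obtain v where v: "v \<in> verts ?S - {s}" "out_degree ?S v \<le> d v" "d' = topple ?S s v d"
      by (auto simp: topples_def)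
    then have "v \<in> verts G - {s}" "out_degree G v \<le> d v" "d' = topple G s v d"
      using vS deg top d by auto
    then show "topples G s d d'" unfolding topples_def by blast
  next
    assume "topples G s d d'"
    then obtain v where v: "v \<in> verts G - {s}" "out_degree G v \<le> d v" "d' = topple G s v d"
      by (auto simp: topples_def)
    then have "d v \<noteq> 0" using out_degree_pos[OF G v(1)] by simp
    then have vs: "v \<in> verts ?S - {s}" using d unfolding config_def by metis
    then have "out_degree ?S v \<le> d v" "d' = topple ?S s v d" using v deg top d by auto
    with vs show "topples ?S s d d'" unfolding topples_def by blast
  qed
  have conf: "config ?S s d'" if "topples ?S s d d'" for d d'
    using that by (auto simp: topples_def config_topple)
  have steps1: "(topples G s)\<^sup>*\<^sup>* c d \<and> config ?S s d" if "(topples ?S s)\<^sup>*\<^sup>* c d" for d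
    using that
  proof induction
    case base
    then show ?case using c by simp
  next
    case (step d d')
    then show ?case using eq[of d d'] conf[of d d'] by (auto intro: rtranclp.rtrancl_into_rtrancl)
  qed
  have steps2: "(topples ?S s)\<^sup>*\<^sup>* c d \<and> config ?S s d" if "(topples G s)\<^sup>*\<^sup>* c d" for d
    using that
  proof induction
    case base
    then show ?case using c by simp
  next
    case (step d d')
    then show ?case using eq[of d d'] conf[of d d'] by (auto intro: rtranclp.rtrancl_into_rtrancl)
  qed
  have stab: "stable ?S s d \<longleftrightarrow> stable G s d" if "config ?S s d" for d
  proof -
    have confG: "config G s d" using that vS by (auto simp: config_def)
    have outside: "d v < out_degree G v" if "v \<in> verts G - {s}" "v \<notin> verts ?S" for v
      using out_degree_pos[OF G that(1)] \<open>config ?S s d\<close> that by (simp add: config_def)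
    have "(\<forall>v\<in>verts ?S - {s}. d v < out_degree ?S v) \<longleftrightarrow>
        (\<forall>v\<in>verts G - {s}. d v < out_degree G v)" (is "?l \<longleftrightarrow> ?r")
    proof
      assume l: ?l
      show ?r
      proof
        fix v assume v: "v \<in> verts G - {s}"
        show "d v < out_degree G v"
        proof (cases "v \<in> verts ?S")
          case True
          then have "d v < out_degree ?S v" using l v by blast
          then show ?thesis using deg[OF True] by simp
        qed (rule outside[OF v])
      qed
    next
      assume r: ?r
      show ?l
      proof
        fix v assume "v \<in> verts ?S - {s}"
        then show "d v < out_degree ?S v" using r vS deg[of v] by auto
      qed
    qed
    then show ?thesis using that confG by (simp add: stable_def)
  qed
  have "((topples ?S s)\<^sup>*\<^sup>* c d \<and> stable ?S s d) = ((topples G s)\<^sup>*\<^sup>* c d \<and> stable G s d)" for d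
    using steps1[of d] steps2[of d] stab[of d] by auto
  then show ?thesis by (simp add: stabilization_def)
qed

end

theory Submission
  imports Defs "HOL-Library.Confluence" "HOL-Algebra.Divisibility"
begin

text \<open>
  The maximal subgroup at \<open>0\<close> is the group of units. Stabilization is a homomorphism from the
  configurations onto the commutative monoid \<open>\<M>\<close>, so a configuration stabilizes to a unit iff
  each single grain on its support does. Toppling \<open>deg\<^sup>+(v)\<close> grains at \<open>v\<close> leaves a configuration
  supported on the successors of \<open>v\<close> in \<open>X\<close>; hence a grain at \<open>v\<close> stabilizes to a unit iff a grain
  at each successor does, and by well-founded induction this is the case if \<open>v\<close> reaches no cycle
  of \<open>X\<close>. Conversely, a vertex that reaches a cycle has a successor that does, so toppling never
  clears the set of these vertices, and no unit has a grain on one of them. So the units are the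
  stable configurations supported on the vertices that reach no cycle, which are the non-sink
  vertices of \<open>\<S>(0)\<close>; these configurations form a group, and a group is its own minimal ideal.
\<close>

section \<open>Subgroups and ideals of a monoid\<close>

lemma (in monoid) subgroup_at_one_Units: "subgroup_at G \<one> (Units G)"
proof -
  have "id \<in> hom (units_of G) G"
    by (auto simp: hom_def units_of_def)
  from group.hom_imp_img_group[OF units_group this] show ?thesis
    by (auto simp: subgroup_at_def units_of_def)
qed

lemma (in monoid) subgroup_at_one_subset_Units:
  assumes "subgroup_at G \<one> H"
  shows "H \<subseteq> Units G"
proof
  fix x assume "x \<in> H"
  interpret H: group "G\<lparr>carrier := H, one := \<one>\<rparr>" using assms by (simp add: subgroup_at_def)
  have "H \<subseteq> carrier G" using assms by (simp add: subgroup_at_def)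
  then show "x \<in> Units G"
    using H.Units_eq \<open>x \<in> H\<close> by (fastforce simp: Units_def)
qed

lemma (in monoid) maximal_subgroup_one: "maximal_subgroup G \<one> = Units G"
  unfolding maximal_subgroup_def
  by (rule the_equality) (use subgroup_at_one_Units subgroup_at_one_subset_Units in blast)+

lemma (in group) monoid_ideal_iff: "monoid_ideal G I \<longleftrightarrow> I = carrier G"
proof
  assume I: "monoid_ideal G I"
  then obtain x where x: "x \<in> I" "x \<in> carrier G" by (auto simp: monoid_ideal_def)
  then have "inv x \<otimes> x \<in> I" using I inv_closed unfolding monoid_ideal_def by blast
  then have "\<one> \<in> I" using x(2) by simp
  then have "a \<in> I" if "a \<in> carrier G" for a
    using I that r_one[OF that] unfolding monoid_ideal_def by metis
  then show "I = carrier G" using I by (auto simp: monoid_ideal_def)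
qed (auto simp: monoid_ideal_def)

lemma (in group) minimal_ideal_eq_carrier: "minimal_ideal G = carrier G"
  unfolding minimal_ideal_def monoid_ideal_iff by (rule the_equality) auto

lemma (in comm_monoid) mult_in_Units_iff:
  assumes "a \<in> carrier G" "b \<in> carrier G"
  shows "a \<otimes> b \<in> Units G \<longleftrightarrow> a \<in> Units G \<and> b \<in> Units G"
  using assms unit_factor[of a b] unit_factor[of b a] by (auto simp: m_comm)


section \<open>Vertices that reach no cycle\<close>

lemma termi_not_trancl_self:
  assumes "x \<in> termi r"
  shows "(x, x) \<notin> r\<^sup>+"
  using assms
proof induction
  case (1 x)
  then show ?case by (metis converseI rtrancl_into_trancl1 tranclD)
qed

lemma in_termi_iff_reaches_no_cycle:
  assumes "finite r"
  shows "x \<in> termi r \<longleftrightarrow> (\<forall>y. (x, y) \<in> r\<^sup>* \<longrightarrow> (y, y) \<notin> r\<^sup>+)"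
proof
  assume "x \<in> termi r"
  then show "\<forall>y. (x, y) \<in> r\<^sup>* \<longrightarrow> (y, y) \<notin> r\<^sup>+"
    using termi_not_trancl_self acc_downwards by (metis rtrancl_converseI)
next
  assume no_cycle: "\<forall>y. (x, y) \<in> r\<^sup>* \<longrightarrow> (y, y) \<notin> r\<^sup>+"
  define r' where "r' = {(y, z) \<in> r. (x, y) \<in> r\<^sup>*}"
  have "r' \<subseteq> r" by (auto simp: r'_def)
  have "acyclic r'"
  proof (rule acyclicI, intro allI notI)
    fix y assume y: "(y, y) \<in> r'\<^sup>+"
    then have "(x, y) \<in> r\<^sup>*" by (auto simp: r'_def dest: tranclD)
    then show False using no_cycle trancl_mono[OF y \<open>r' \<subseteq> r\<close>] by blast
  qed
  moreover have "finite r'" using assms \<open>r' \<subseteq> r\<close> by (rule finite_subset[rotated])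
  ultimately have "wf (r'\<inverse>)" by (rule finite_acyclic_wf_converse[rotated])
  then have "y \<in> termi r" if "(x, y) \<in> r\<^sup>*" for y
    using that
  proof (induction y)
    case (less y)
    show ?case
    proof (rule accI)
      fix z assume "(z, y) \<in> r\<inverse>"
      then have "(y, z) \<in> r" by simp
      with less.prems have "(x, z) \<in> r\<^sup>*" by (rule rtrancl_into_rtrancl)
      then show "z \<in> termi r"
        using less \<open>(y, z) \<in> r\<close> by (simp add: r'_def)
    qed
  qed
  then show "x \<in> termi r" by simp
qed

lemma (in wf_digraph) is_cycle_reachable1:
  assumes "is_cycle G p" "x \<in> tail G ` set p" "y \<in> tail G ` set p"
  shows "x \<rightarrow>\<^sup>+ y"
proof -
  obtain u where u: "awalk u p u" using assms(1) by (auto simp: is_cycle_def)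
  have via_u: "z \<rightarrow>\<^sup>+ u \<and> u \<rightarrow>\<^sup>* z" if "z \<in> tail G ` set p" for z
  proof -
    from that obtain a where a: "a \<in> set p" "z = tail G a" by blast
    then obtain q r where "p = q @ a # r" by (auto simp: in_set_conv_decomp)
    then have "awalk u q z" "awalk z (a # r) u" using u a by (auto simp: awalk_Cons_iff)
    then show ?thesis unfolding reachable_awalk reachable1_awalk by blast
  qed
  show ?thesis using via_u[OF assms(2)] via_u[OF assms(3)] reachable1_reachable_trans by blast
qed

lemma (in wf_digraph) reachable1_self_cycleE:
  assumes "x \<rightarrow>\<^sup>+ x"
  obtains p where "is_cycle G p" "x \<in> tail G ` set p"
proof -
  obtain p where p: "awalk x p x" "p \<noteq> []" using assms unfolding reachable1_awalk by blast
  then have "x = tail G (hd p)" by (cases p) (auto simp: awalk_Cons_iff)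
  then have "x \<in> tail G ` set p" using p(2) by simp
  moreover have "is_cycle G p" using p by (auto simp: is_cycle_def)
  ultimately show thesis by (rule that[rotated])
qed

lemma (in wf_digraph) acyclic_vertex_iff: "acyclic_vertex G v \<longleftrightarrow> v \<in> verts G \<and> \<not> v \<rightarrow>\<^sup>+ v"
  unfolding acyclic_vertex_def
  using is_cycle_reachable1 reachable1_self_cycleE by metis

lemma (in wf_digraph) strong_component_scc_of:
  assumes "v \<in> verts G"
  shows "strong_component G (scc_of v)"
  using in_scc_of_self[OF assms] reachable_in_verts(2) reachable_trans
  unfolding strong_component_def strongly_connected_set_def scc_of_def by blast

lemma (in wf_digraph) cyclic_strong_component_iff:
  assumes "strong_component G W"
  shows "cyclic_set G W \<longleftrightarrow> (\<exists>x\<in>W. x \<rightarrow>\<^sup>+ x)"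
proof
  assume "cyclic_set G W"
  then obtain p where p: "is_cycle G p" "tail G ` set p \<subseteq> W" by (auto simp: cyclic_set_def)
  then have "tail G (hd p) \<in> tail G ` set p" by (simp add: is_cycle_def)
  then show "\<exists>x\<in>W. x \<rightarrow>\<^sup>+ x" using is_cycle_reachable1[OF p(1)] p(2) by blast
next
  assume "\<exists>x\<in>W. x \<rightarrow>\<^sup>+ x"
  then obtain x p where x: "x \<in> W" and p: "is_cycle G p" "x \<in> tail G ` set p"
    using reachable1_self_cycleE by metis
  have "tail G ` set p \<subseteq> scc_of x"
    using is_cycle_reachable1[OF p(1)] p(2) by (auto simp: scc_of_def)
  also have "scc_of x \<subseteq> W"
  proof -
    have "W \<subseteq> scc_of x" and "x \<in> verts G"
      using assms x by (auto simp: strong_component_def strongly_connected_set_def scc_of_def)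
    then show ?thesis
      using assms strong_component_scc_of unfolding strong_component_def by blast
  qed
  finally show "cyclic_set G W" using p(1) by (auto simp: cyclic_set_def)
qed

lemma (in wf_digraph) A_set_zero_iff_reaches_no_cycle:
  "v \<in> A_set G (\<lambda>_. 0) \<longleftrightarrow> v \<in> verts G \<and> (\<forall>x. v \<rightarrow>\<^sup>* x \<longrightarrow> \<not> x \<rightarrow>\<^sup>+ x)"
proof (intro iffI conjI allI impI notI)
  fix x assume v: "v \<in> A_set G (\<lambda>_. 0)" and x: "v \<rightarrow>\<^sup>* x" "x \<rightarrow>\<^sup>+ x"
  then have "x \<in> verts G" using reachable_in_verts by blast
  then have "strong_component G (scc_of x)" "x \<in> scc_of x"
    by (rule strong_component_scc_of in_scc_of_self)+
  moreover then have "cyclic_set G (scc_of x)" using x(2) cyclic_strong_component_iff by blast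
  ultimately show False using v x(1) by (fastforce simp: A_set_def supp_def)
next
  assume no_cycle: "v \<in> verts G \<and> (\<forall>x. v \<rightarrow>\<^sup>* x \<longrightarrow> \<not> x \<rightarrow>\<^sup>+ x)"
  then have "acyclic_vertex G v" by (auto simp: acyclic_vertex_iff)
  moreover have "\<not> cyclic_set G W" if "strong_component G W" "w \<in> W" "v \<rightarrow>\<^sup>* w" for W w
    using that no_cycle cyclic_strong_component_iff[OF that(1)] reachable_trans[OF that(3)]
    by (auto simp: strong_component_def strongly_connected_set_def)
  ultimately show "v \<in> A_set G (\<lambda>_. 0)"
    using no_cycle by (auto simp: A_set_def cl_def supp_def)
qed (auto simp: A_set_def)

lemma (in fin_digraph) A_set_zero_eq_termi: "A_set G (\<lambda>_. 0) = verts G \<inter> termi (arcs_ends G)"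
proof -
  have "finite (arcs_ends G)" by (simp add: arcs_ends_def)
  then have "v \<in> termi (arcs_ends G) \<longleftrightarrow> (\<forall>x. v \<rightarrow>\<^sup>* x \<longrightarrow> \<not> x \<rightarrow>\<^sup>+ x)"
    if "v \<in> verts G" for v
    using that by (simp add: in_termi_iff_reaches_no_cycle reachable_conv')
  then show ?thesis by (auto simp: A_set_zero_iff_reaches_no_cycle)
qed


section \<open>Configurations and topplings\<close>

definition grain :: "'v \<Rightarrow> 'v \<Rightarrow> nat" where
  "grain v = (\<lambda>w. if w = v then 1 else 0)"

lemma supp_grain: "supp (grain v) = {v}"
  by (auto simp: supp_def grain_def)

lemma supp_add: "supp (\<lambda>v. c v + d v) = supp c \<union> supp d"
  by (auto simp: supp_def)

lemma config_iff_supp: "config G s c \<longleftrightarrow> supp c \<subseteq> verts G - {s}"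
  by (auto simp: config_def supp_def Suc_le_eq)

lemma config_zero: "config G s (\<lambda>_. 0)"
  by (simp add: config_def)

lemma config_add: "config G s c \<Longrightarrow> config G s d \<Longrightarrow> config G s (\<lambda>v. c v + d v)"
  by (simp add: config_def)

lemma config_grain: "v \<in> verts G - {s} \<Longrightarrow> config G s (grain v)"
  by (simp add: config_iff_supp supp_grain)

lemma config_induct [consumes 2, case_names zero add_grain]:
  assumes "finite (verts G)" and "config G s c"
    and zero: "P (\<lambda>_. 0)"
    and add_grain: "\<And>v c. v \<in> verts G - {s} \<Longrightarrow> config G s c \<Longrightarrow> P c \<Longrightarrow> P (\<lambda>w. grain v w + c w)"
  shows "P c"
  using \<open>config G s c\<close>
proof (induction "\<Sum>v\<in>verts G. c v" arbitrary: c)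
  case 0
  then have "c = (\<lambda>_. 0)" using \<open>finite (verts G)\<close> by (auto simp: config_def)
  then show ?case using zero by simp
next
  case (Suc n)
  then obtain v where v: "v \<in> verts G" "0 < c v"
    by (metis gr0I sum.neutral nat.distinct(1))
  define d where "d = c(v := c v - 1)"
  have c_eq: "c = (\<lambda>w. grain v w + d w)" using v by (auto simp: d_def grain_def)
  have "v \<in> verts G - {s}" using Suc.prems v by (auto simp: config_def)
  moreover have "config G s d" using Suc.prems by (simp add: config_def d_def)
  moreover have "Suc n = (\<Sum>w\<in>verts G. grain v w + d w)"
    using Suc.hyps(2) by (subst (asm) c_eq)
  then have "n = (\<Sum>w\<in>verts G. d w)"
    using v \<open>finite (verts G)\<close> by (simp add: sum.distrib grain_def)
  ultimately show ?case by (subst c_eq) (intro add_grain Suc.hyps(1))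
qed

lemma topples_config: "topples G s c c' \<Longrightarrow> config G s c'"
  by (auto simp: topples_def config_topple)

lemma stable_config: "stable G s c \<Longrightarrow> config G s c"
  by (simp add: stable_def)

lemma stable_iff_supp:
  assumes "\<And>v. v \<in> verts G - {s} \<Longrightarrow> 0 < out_degree G v"
  shows "stable G s c \<longleftrightarrow> config G s c \<and> (\<forall>v\<in>supp c. c v < out_degree G v)"
proof (intro iffI conjI)
  assume "config G s c \<and> (\<forall>v\<in>supp c. c v < out_degree G v)"
  then have "c v < out_degree G v" if "v \<in> verts G - {s}" for v
    using assms[OF that] by (cases "v \<in> supp c") (auto simp: supp_def)
  then show "stable G s c" using \<open>config G s c \<and> _\<close> by (simp add: stable_def)
next
  assume stable: "stable G s c"
  then show "config G s c" by (rule stable_config)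
  then show "\<forall>v\<in>supp c. c v < out_degree G v"
    using stable by (auto simp: stable_def config_iff_supp)
qed

lemma stable_not_topples: "stable G s c \<Longrightarrow> \<not> topples G s c c'"
  by (auto simp: stable_def topples_def not_le[symmetric])

lemma stable_if_not_topples: "config G s c \<Longrightarrow> \<nexists>c'. topples G s c c' \<Longrightarrow> stable G s c"
  by (auto simp: stable_def topples_def not_le[symmetric])

lemma topples_add:
  assumes "topples G s c c'" "config G s d"
  shows "topples G s (\<lambda>v. c v + d v) (\<lambda>v. c' v + d v)"
proof -
  obtain v where v: "v \<in> verts G - {s}" "out_degree G v \<le> c v" "c' = topple G s v c"
    using assms(1) by (auto simp: topples_def)
  have "(\<lambda>w. c' w + d w) = topple G s v (\<lambda>w. c w + d w)"
    using v assms(2) by (auto simp: fun_eq_iff topple_def config_def)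
  then show ?thesis using v unfolding topples_def by (intro bexI[of _ v]) auto
qed

lemma topples_rtranclp_add:
  assumes "(topples G s)\<^sup>*\<^sup>* c c'" "config G s d"
  shows "(topples G s)\<^sup>*\<^sup>* (\<lambda>v. c v + d v) (\<lambda>v. c' v + d v)"
  using assms(1)
  by induction (auto intro: rtranclp.rtrancl_into_rtrancl topples_add[OF _ assms(2)])

lemma confluentp_topples: "confluentp (topples G s)"
proof (rule strong_confluentp_imp_confluentp, rule strong_confluentpI)
  fix c c\<^sub>1 c\<^sub>2
  assume "topples G s c c\<^sub>1" "topples G s c c\<^sub>2"
  then obtain v w where
    v: "v \<in> verts G - {s}" "out_degree G v \<le> c v" "c\<^sub>1 = topple G s v c" and
    w: "w \<in> verts G - {s}" "out_degree G w \<le> c w" "c\<^sub>2 = topple G s w c"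
    by (auto simp: topples_def)
  show "\<exists>d. (topples G s)\<^sup>*\<^sup>* c\<^sub>1 d \<and> (topples G s)\<^sup>=\<^sup>= c\<^sub>2 d"
  proof (cases "v = w")
    case True
    then show ?thesis using v w by auto
  next
    case False
    then have "topple G s w c\<^sub>1 = topple G s v c\<^sub>2"
      using v w by (auto simp: fun_eq_iff topple_def)
    moreover have "out_degree G w \<le> c\<^sub>1 w" "out_degree G v \<le> c\<^sub>2 v"
      using False v w by (auto simp: topple_def)
    ultimately have "topples G s c\<^sub>1 (topple G s w c\<^sub>1)" "topples G s c\<^sub>2 (topple G s w c\<^sub>1)"
      using v(1) w(1) unfolding topples_def by auto
    then show ?thesis by blast
  qed
qed

lemma stabilization_eqI:
  assumes "(topples G s)\<^sup>*\<^sup>* c d" "stable G s d"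
  shows "stabilization G s c = d"
  unfolding stabilization_def
proof (rule the_equality)
  fix d' assume d': "(topples G s)\<^sup>*\<^sup>* c d' \<and> stable G s d'"
  then obtain u where "(topples G s)\<^sup>*\<^sup>* d u" "(topples G s)\<^sup>*\<^sup>* d' u"
    using confluentpD[OF confluentp_topples assms(1)] by blast
  then show "d' = d"
    using assms(2) d' stable_not_topples by (metis converse_rtranclpE)
qed (use assms in simp)


section \<open>Termination of toppling\<close>

lemma (in fin_digraph) sum_topple:
  fixes h :: "'a \<Rightarrow> nat"
  assumes v: "v \<in> verts G - {s}" "out_degree G v \<le> c v" and "h s = 0"
  shows "(\<Sum>w\<in>verts G. h w * topple G s v c w) + out_degree G v * h v =
    (\<Sum>w\<in>verts G. h w * c w) + (\<Sum>a\<in>out_arcs G v. h (head G a))"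
proof -
  let ?arcs_to = "\<lambda>w. out_arcs G v \<inter> in_arcs G w"
  have "(\<Sum>w\<in>verts G. h w * card (?arcs_to w)) =
      (\<Sum>w\<in>verts G. \<Sum>a\<in>{a \<in> out_arcs G v. head G a = w}. h (head G a))"
    by (rule sum.cong) (auto intro: arg_cong[of _ _ card])
  also have "\<dots> = (\<Sum>a\<in>out_arcs G v. h (head G a))"
    by (rule sum.group) auto
  finally have received: "(\<Sum>w\<in>verts G. h w * card (?arcs_to w)) =
      (\<Sum>a\<in>out_arcs G v. h (head G a))" .
  have "h w * topple G s v c w + (if w = v then out_degree G v * h v else 0) =
      h w * c w + h w * card (?arcs_to w)" if "w \<in> verts G" for w
    using that assms by (auto simp: topple_def distrib_left[symmetric] mult.commute[of _ "h v"])
  then have "(\<Sum>w\<in>verts G. h w * topple G s v c w) +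
      (\<Sum>w\<in>verts G. if w = v then out_degree G v * h v else 0) =
      (\<Sum>w\<in>verts G. h w * c w) + (\<Sum>w\<in>verts G. h w * card (?arcs_to w))"
    unfolding sum.distrib[symmetric] by (rule sum.cong[OF refl])
  then show ?thesis using v(1) received by simp
qed

locale sandpile =
  fixes G :: "('v, 'e) pre_digraph" (structure) and s :: 'v
  assumes sandpile_graph: "sandpile_graph G s"

sublocale sandpile \<subseteq> fin_digraph G
  using sandpile_graph by (simp add: sandpile_graph_def)

context sandpile
begin

definition sink_distance :: "'v \<Rightarrow> nat" where
  "sink_distance v = (LEAST n. (v, s) \<in> arcs_ends G ^^ n)"

lemma ex_closer_successor:
  assumes v: "v \<in> verts G - {s}"
  obtains w where "v \<rightarrow>\<^bsub>G\<^esub> w" "sink_distance w < sink_distance v"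
proof -
  have "v \<rightarrow>\<^sup>* s" using v sandpile_graph by (auto simp: sandpile_graph_def)
  then have "\<exists>n. (v, s) \<in> arcs_ends G ^^ n"
    using reachable_rtranclI rtrancl_imp_relpow by metis
  then have path: "(v, s) \<in> arcs_ends G ^^ sink_distance v"
    unfolding sink_distance_def by (rule LeastI_ex)
  moreover have "sink_distance v \<noteq> 0" using path v by (metis DiffE insertI1 relpow_0_E)
  ultimately obtain n w where n: "sink_distance v = Suc n"
    and w: "v \<rightarrow>\<^bsub>G\<^esub> w" "(w, s) \<in> arcs_ends G ^^ n"
    by (metis not0_implies_Suc relpow_Suc_E2)
  have "sink_distance w \<le> n" unfolding sink_distance_def by (rule Least_le) (fact w(2))
  then show thesis using that w(1) n by simp
qed

lemma ex_strictly_subharmonic: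
  obtains g :: "'v \<Rightarrow> nat" where "\<And>v. g v \<le> g s"
    "\<And>v. v \<in> verts G - {s} \<Longrightarrow> out_degree G v * g v < (\<Sum>a\<in>out_arcs G v. g (head G a))"
proof
  define D where "D = Max (sink_distance ` verts G)"
  define K where "K = Suc (card (arcs G))"
  define g where "g v = K ^ (D - sink_distance v)" for v
  have "sink_distance s = 0" by (simp add: sink_distance_def)
  then show "g v \<le> g s" for v by (simp add: g_def K_def power_increasing)
  \<comment> \<open>A successor closer to the sink than \<open>v\<close> already contributes at least \<open>K * g v\<close>.\<close>
  show "out_degree G v * g v < (\<Sum>a\<in>out_arcs G v. g (head G a))" if v: "v \<in> verts G - {s}" for v
  proof -
    obtain w where w: "v \<rightarrow>\<^bsub>G\<^esub> w" "sink_distance w < sink_distance v"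
      using ex_closer_successor[OF v] .
    then obtain a where a: "a \<in> out_arcs G v" "head G a = w" by auto
    have "out_degree G v < K"
      using card_mono[OF finite_arcs, of "out_arcs G v"]
      by (simp add: K_def out_degree_def out_arcs_def)
    then have "out_degree G v * g v < K * g v"
      by (rule mult_strict_right_mono) (simp add: g_def K_def)
    also have "sink_distance v \<le> D" using v by (simp add: D_def)
    then have "Suc (D - sink_distance v) \<le> D - sink_distance w" using w(2) by simp
    then have "K * g v \<le> g w" using power_increasing[of _ _ K] by (fastforce simp: g_def K_def)
    also have "g w \<le> (\<Sum>a\<in>out_arcs G v. g (head G a))"
      using member_le_sum[OF a(1), of "\<lambda>a. g (head G a)"] a(2) finite_out_arcs by simp
    finally show ?thesis .
  qed
qed

lemma ex_strictly_superharmonic: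
  obtains h :: "'v \<Rightarrow> nat" where "h s = 0"
    "\<And>v. v \<in> verts G - {s} \<Longrightarrow> (\<Sum>a\<in>out_arcs G v. h (head G a)) < out_degree G v * h v"
proof -
  obtain g :: "'v \<Rightarrow> nat" where le_sink: "\<And>v. g v \<le> g s" and subharmonic:
    "\<And>v. v \<in> verts G - {s} \<Longrightarrow> out_degree G v * g v < (\<Sum>a\<in>out_arcs G v. g (head G a))"
    using ex_strictly_subharmonic by blast
  define h where "h v = g s - g v" for v
  have complement: "h v + g v = g s" for v using le_sink by (simp add: h_def)
  have sums: "(\<Sum>a\<in>out_arcs G v. h (head G a)) + (\<Sum>a\<in>out_arcs G v. g (head G a)) =
      out_degree G v * h v + out_degree G v * g v" for v
    by (simp add: complement out_degree_def flip: sum.distrib distrib_left)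
  have "(\<Sum>a\<in>out_arcs G v. h (head G a)) < out_degree G v * h v" if "v \<in> verts G - {s}" for v
    using sums[of v] subharmonic[OF that] by linarith
  moreover have "h s = 0" by (simp add: h_def)
  ultimately show thesis by (rule that[rotated])
qed

lemma wfp_topples: "wfp (topples G s)\<inverse>\<inverse>"
proof -
  obtain h :: "'v \<Rightarrow> nat" where h: "h s = 0"
    "\<And>v. v \<in> verts G - {s} \<Longrightarrow> (\<Sum>a\<in>out_arcs G v. h (head G a)) < out_degree G v * h v"
    using ex_strictly_superharmonic by blast
  define potential where "potential c = (\<Sum>w\<in>verts G. h w * c w)" for c
  have "potential c' < potential c" if "topples G s c c'" for c c'
  proof -
    from that obtain v where v: "v \<in> verts G - {s}" "out_degree G v \<le> c v" "c' = topple G s v c"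
      by (auto simp: topples_def)
    show ?thesis
      using sum_topple[of v s c h] v h(1) h(2)[OF v(1)] by (simp add: potential_def)
  qed
  then show ?thesis by (intro wfp_if_convertible_to_nat[of _ potential]) blast
qed

lemma ex_stabilization:
  assumes "config G s c"
  shows "\<exists>d. (topples G s)\<^sup>*\<^sup>* c d \<and> stable G s d"
  using wfp_topples assms
proof (induction c rule: wfp_induct_rule)
  case (less c)
  show ?case
  proof (cases "stable G s c")
    case False
    then obtain c' where c': "topples G s c c'"
      using stable_if_not_topples[OF less.prems] by blast
    then show ?thesis
      using less.IH[OF conversepI, OF c' topples_config[OF c']] converse_rtranclp_into_rtranclp
      by metis
  qed blast
qed

lemma topples_stabilization:
  assumes "config G s c"
  shows "(topples G s)\<^sup>*\<^sup>* c (stabilization G s c)"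
  using ex_stabilization[OF assms] stabilization_eqI by metis

lemma stable_stabilization:
  assumes "config G s c"
  shows "stable G s (stabilization G s c)"
  using ex_stabilization[OF assms] stabilization_eqI by metis

end


section \<open>The sandpile monoid\<close>

lemma carrier_sandpile_monoid: "carrier (sandpile_monoid G s) = {c. stable G s c}"
  by (simp add: sandpile_monoid_def)

lemma carrier_sandpile_monoid_only_sink:
  assumes "verts G = {s}"
  shows "carrier (sandpile_monoid G s) = {\<lambda>_. 0}"
  using assms by (auto simp: carrier_sandpile_monoid stable_def config_def)

lemma mult_sandpile_monoid: "a \<otimes>\<^bsub>sandpile_monoid G s\<^esub> b = stabilization G s (\<lambda>v. a v + b v)"
  by (simp add: sandpile_monoid_def)

lemma one_sandpile_monoid: "\<one>\<^bsub>sandpile_monoid G s\<^esub> = (\<lambda>_. 0)"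
  by (simp add: sandpile_monoid_def)

context sandpile
begin

abbreviation M :: "('v \<Rightarrow> nat) monoid" where "M \<equiv> sandpile_monoid G s"

lemma stabilization_stable: "stable G s c \<Longrightarrow> stabilization G s c = c"
  by (rule stabilization_eqI) auto

lemma stabilization_in_carrier: "config G s c \<Longrightarrow> stabilization G s c \<in> carrier M"
  by (simp add: carrier_sandpile_monoid stable_stabilization)

lemma stabilization_zero: "stabilization G s (\<lambda>_. 0) = \<one>\<^bsub>M\<^esub>"
proof -
  have "stable G s (\<lambda>_. 0)"
    using out_degree_pos[OF sandpile_graph] by (simp add: stable_def config_zero)
  then show ?thesis by (simp add: stabilization_stable one_sandpile_monoid)
qed

lemma stabilization_topples:
  assumes "config G s d" "(topples G s)\<^sup>*\<^sup>* c d"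
  shows "stabilization G s c = stabilization G s d"
  using topples_stabilization[OF assms(1)] stable_stabilization[OF assms(1)] assms(2)
  by (intro stabilization_eqI) auto

lemma stabilization_add:
  assumes "config G s c" "config G s d"
  shows "stabilization G s (\<lambda>v. c v + d v) = stabilization G s c \<otimes>\<^bsub>M\<^esub> stabilization G s d"
proof -
  let ?c = "stabilization G s c" and ?d = "stabilization G s d"
  note config = assms[THEN stable_stabilization, THEN stable_config]
  have "(topples G s)\<^sup>*\<^sup>* (\<lambda>v. c v + d v) (\<lambda>v. ?c v + d v)"
    using topples_stabilization[OF assms(1)] assms(2) by (rule topples_rtranclp_add)
  moreover have "(topples G s)\<^sup>*\<^sup>* (\<lambda>v. d v + ?c v) (\<lambda>v. ?d v + ?c v)"
    using topples_stabilization[OF assms(2)] config(1) by (rule topples_rtranclp_add)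
  then have "(topples G s)\<^sup>*\<^sup>* (\<lambda>v. ?c v + d v) (\<lambda>v. ?c v + ?d v)"
    by (simp only: add.commute)
  ultimately have "(topples G s)\<^sup>*\<^sup>* (\<lambda>v. c v + d v) (\<lambda>v. ?c v + ?d v)"
    by (rule rtranclp_trans)
  then show ?thesis
    unfolding mult_sandpile_monoid by (rule stabilization_topples[OF config_add[OF config]])
qed

lemma comm_monoid_sandpile_monoid: "comm_monoid M"
proof (rule comm_monoidI)
  fix a b c assume "a \<in> carrier M" "b \<in> carrier M" "c \<in> carrier M"
  then have stable: "stable G s a" "stable G s b" "stable G s c"
    by (simp_all add: carrier_sandpile_monoid)
  note config = stable[THEN stable_config]
  have "a \<otimes>\<^bsub>M\<^esub> b \<otimes>\<^bsub>M\<^esub> c = stabilization G s (\<lambda>v. (a v + b v) + c v)"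
    using config stable by (simp add: stabilization_add config_add stabilization_stable)
  also have "\<dots> = stabilization G s (\<lambda>v. a v + (b v + c v))"
    by (simp add: add.assoc)
  also have "\<dots> = a \<otimes>\<^bsub>M\<^esub> (b \<otimes>\<^bsub>M\<^esub> c)"
    using config stable by (simp add: stabilization_add config_add stabilization_stable)
  finally show "a \<otimes>\<^bsub>M\<^esub> b \<otimes>\<^bsub>M\<^esub> c = a \<otimes>\<^bsub>M\<^esub> (b \<otimes>\<^bsub>M\<^esub> c)" .
next
  show "\<one>\<^bsub>M\<^esub> \<in> carrier M"
    using stabilization_in_carrier[OF config_zero] by (simp add: stabilization_zero)
next
  fix a b assume "a \<in> carrier M" "b \<in> carrier M"
  then have "config G s (\<lambda>v. a v + b v)"
    by (simp add: carrier_sandpile_monoid config_add stable_config)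
  then show "a \<otimes>\<^bsub>M\<^esub> b \<in> carrier M"
    by (simp add: mult_sandpile_monoid stabilization_in_carrier)
  show "a \<otimes>\<^bsub>M\<^esub> b = b \<otimes>\<^bsub>M\<^esub> a"
    by (simp add: mult_sandpile_monoid add.commute)
next
  fix a assume "a \<in> carrier M"
  then show "\<one>\<^bsub>M\<^esub> \<otimes>\<^bsub>M\<^esub> a = a"
    by (simp add: carrier_sandpile_monoid mult_sandpile_monoid one_sandpile_monoid
        stabilization_stable)
qed

sublocale M: comm_monoid M
  by (rule comm_monoid_sandpile_monoid)


section \<open>The units of the sandpile monoid\<close>

abbreviation X :: "('v, 'e) pre_digraph" where "X \<equiv> del_vert s"

sublocale X: fin_digraph X
  by (rule fin_digraph_del_vert)

lemma stabilization_in_Units_iff: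
  assumes "config G s c"
  shows "stabilization G s c \<in> Units M \<longleftrightarrow> (\<forall>v\<in>supp c. stabilization G s (grain v) \<in> Units M)"
  using finite_verts assms
proof (induction rule: config_induct)
  case zero
  then show ?case by (simp add: stabilization_zero supp_def)
next
  case (add_grain v c)
  then show ?case
    by (simp add: stabilization_add config_grain M.mult_in_Units_iff stabilization_in_carrier
        supp_add supp_grain)
qed

lemma dominates_del_vert_iff: "v \<rightarrow>\<^bsub>X\<^esub> w \<longleftrightarrow> v \<rightarrow>\<^bsub>G\<^esub> w \<and> v \<noteq> s \<and> w \<noteq> s"
  by (auto simp: arcs_ends_def arc_to_ends_def del_vert_simps)

lemma card_arcs_between_pos_iff: "0 < card (out_arcs G v \<inter> in_arcs G w) \<longleftrightarrow> v \<rightarrow>\<^bsub>G\<^esub> w"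
  by (auto simp: card_gt_0_iff arcs_ends_def arc_to_ends_def)

lemma supp_topple_out_degree_grain:
  assumes "v \<in> verts G - {s}"
  shows "supp (topple G s v (\<lambda>w. out_degree G v * grain v w)) = {w. v \<rightarrow>\<^bsub>X\<^esub> w}"
  using assms
  by (auto simp: supp_def topple_def grain_def Suc_le_eq card_arcs_between_pos_iff
      dominates_del_vert_iff)

lemma stabilization_grain_in_Units_iff:
  assumes v: "v \<in> verts G - {s}"
  shows "stabilization G s (grain v) \<in> Units M \<longleftrightarrow>
    (\<forall>w. v \<rightarrow>\<^bsub>X\<^esub> w \<longrightarrow> stabilization G s (grain w) \<in> Units M)"
proof -
  let ?c = "\<lambda>w. out_degree G v * grain v w"
  have "supp ?c = {v}"
    using out_degree_pos[OF sandpile_graph v] by (auto simp: supp_def grain_def)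
  then have "stabilization G s (grain v) \<in> Units M \<longleftrightarrow> stabilization G s ?c \<in> Units M"
    using v stabilization_in_Units_iff[of ?c] by (simp add: config_iff_supp)
  also have "topples G s ?c (topple G s v ?c)"
    using v by (auto simp: topples_def grain_def)
  then have "stabilization G s ?c = stabilization G s (topple G s v ?c)"
    by (intro stabilization_topples config_topple) simp
  finally show ?thesis
    by (simp add: stabilization_in_Units_iff config_topple supp_topple_out_degree_grain[OF v])
qed

lemma stabilization_grain_in_Units_if_A_set:
  assumes "v \<in> A_set X (\<lambda>_. 0)"
  shows "stabilization G s (grain v) \<in> Units M"
proof -
  have "v \<in> termi (arcs_ends X)" "v \<in> verts X"
    using assms by (simp_all add: X.A_set_zero_eq_termi)
  then show ?thesis
  proof induction
    case (1 v)
    then show ?case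
      using X.adj_in_verts by (subst stabilization_grain_in_Units_iff) (auto simp: del_vert_simps)
  qed
qed

lemma topples_supp_inter_nonempty:
  assumes "topples G s c d" and succ: "\<And>v. v \<in> W \<Longrightarrow> \<exists>w\<in>W. v \<rightarrow>\<^bsub>X\<^esub> w" and "supp c \<inter> W \<noteq> {}"
  shows "supp d \<inter> W \<noteq> {}"
proof -
  obtain u where u: "u \<in> verts G - {s}" "d = topple G s u c"
    using assms(1) by (auto simp: topples_def)
  obtain v where v: "v \<in> supp c" "v \<in> W" using assms(3) by blast
  then obtain w where w: "w \<in> W" "v \<rightarrow>\<^bsub>X\<^esub> w" using succ by blast
  then have "v \<in> verts G - {s}" "w \<in> verts G - {s}"
    using X.adj_in_verts by (auto simp: del_vert_simps)
  show ?thesis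
  proof (cases "u = v")
    case True
    then have "0 < d w"
      using u w \<open>w \<in> verts G - {s}\<close> card_arcs_between_pos_iff
      by (auto simp: topple_def dominates_del_vert_iff)
    then show ?thesis using w(1) by (auto simp: supp_def Suc_le_eq)
  next
    case False
    then have "0 < d v" using u v \<open>v \<in> verts G - {s}\<close> by (auto simp: topple_def supp_def)
    then show ?thesis using v(2) by (auto simp: supp_def Suc_le_eq)
  qed
qed

lemma supp_subset_A_set_if_stabilization_zero:
  assumes "config G s c" "stabilization G s c = (\<lambda>_. 0)"
  shows "supp c \<subseteq> A_set X (\<lambda>_. 0)"
proof -
  let ?W = "verts X - A_set X (\<lambda>_. 0)"
  have succ: "\<exists>w\<in>?W. v \<rightarrow>\<^bsub>X\<^esub> w" if "v \<in> ?W" for v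
  proof -
    have "v \<notin> termi (arcs_ends X)" using that by (simp add: X.A_set_zero_eq_termi)
    then obtain w where "v \<rightarrow>\<^bsub>X\<^esub> w" "w \<notin> termi (arcs_ends X)"
      by (rule not_acc_down) simp
    then show ?thesis using X.adj_in_verts by (auto simp: X.A_set_zero_eq_termi)
  qed
  have "supp d \<inter> ?W \<noteq> {}" if "(topples G s)\<^sup>*\<^sup>* c d" "supp c \<inter> ?W \<noteq> {}" for d
    using that
  proof induction
    case (step d d')
    then show ?case using topples_supp_inter_nonempty[OF step.hyps(2) succ] by blast
  qed
  then have "supp c \<inter> ?W = {}"
    using topples_stabilization[OF assms(1)] by (auto simp: assms(2) supp_def)
  then show ?thesis using assms(1) by (auto simp: config_iff_supp del_vert_simps)
qed

lemma Units_sandpile_monoid: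
  "Units M = {c. stable G s c \<and> supp c \<subseteq> A_set X (\<lambda>_. 0)}"
proof (intro equalityI subsetI)
  fix c assume "c \<in> Units M"
  then obtain d where "stable G s c" "stable G s d" "c \<otimes>\<^bsub>M\<^esub> d = \<one>\<^bsub>M\<^esub>"
    by (auto simp: Units_def carrier_sandpile_monoid)
  then have "supp (\<lambda>v. c v + d v) \<subseteq> A_set X (\<lambda>_. 0)"
    by (intro supp_subset_A_set_if_stabilization_zero config_add stable_config)
      (simp_all add: mult_sandpile_monoid one_sandpile_monoid)
  then show "c \<in> {c. stable G s c \<and> supp c \<subseteq> A_set X (\<lambda>_. 0)}"
    using \<open>stable G s c\<close> by (simp add: supp_add)
next
  fix c assume c: "c \<in> {c. stable G s c \<and> supp c \<subseteq> A_set X (\<lambda>_. 0)}"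
  then have "stabilization G s c \<in> Units M"
    using stabilization_grain_in_Units_if_A_set
    by (subst stabilization_in_Units_iff) (auto intro: stable_config)
  then show "c \<in> Units M" using c by (simp add: stabilization_stable)
qed


section \<open>The sandpile monoid of \<open>\<S>(0)\<close>\<close>

lemma stable_S_graph_iff:
  assumes "out_arcs G s = {}"
  shows "stable (S_graph G s e) s c \<longleftrightarrow> stable G s c \<and> supp c \<subseteq> S_verts G s e"
proof -
  have verts: "verts (S_graph G s e) = S_verts G s e" by (simp add: S_graph_def)
  have subset: "S_verts G s e \<subseteq> verts G"
    using S_verts_subset[of s G] sandpile_graph by (simp add: sandpile_graph_def)
  have out_degree: "out_degree (S_graph G s e) v = out_degree G v" if "v \<in> S_verts G s e" for v
    using that arcs_S_graph[OF wf_digraph assms, of e]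
    by (auto simp: out_degree_def out_arcs_def S_graph_def intro: arg_cong[of _ _ card])
  have pos: "0 < out_degree G v" if "v \<in> verts G - {s}" for v
    using out_degree_pos[OF sandpile_graph that] .
  have "stable (S_graph G s e) s c \<longleftrightarrow>
      supp c \<subseteq> S_verts G s e - {s} \<and> (\<forall>v\<in>supp c. c v < out_degree (S_graph G s e) v)"
    using pos subset out_degree
    by (subst stable_iff_supp) (auto simp: verts config_iff_supp)
  also have "\<dots> \<longleftrightarrow> supp c \<subseteq> S_verts G s e - {s} \<and> (\<forall>v\<in>supp c. c v < out_degree G v)"
    using out_degree by (metis DiffD1 subsetD)
  also have "\<dots> \<longleftrightarrow> stable G s c \<and> supp c \<subseteq> S_verts G s e"
    using pos subset by (subst stable_iff_supp) (auto simp: config_iff_supp)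
  finally show ?thesis .
qed

lemma carrier_sandpile_monoid_S_graph_zero:
  assumes "out_arcs G s = {}"
  shows "carrier (sandpile_monoid (S_graph G s (\<lambda>_. 0)) s) = Units M"
proof -
  have "S_verts G s (\<lambda>_. 0) = insert s (A_set X (\<lambda>_. 0))"
    by (auto simp: S_verts_def Let_def cl_def supp_def)
  moreover have "s \<notin> supp c" if "stable G s c" for c
    using stable_config[OF that] by (auto simp: config_iff_supp)
  ultimately show ?thesis
    unfolding Units_sandpile_monoid
    by (auto simp: carrier_sandpile_monoid stable_S_graph_iff[OF assms])
qed

lemma group_sandpile_monoid_S_graph_zero:
  assumes "out_arcs G s = {}"
  shows "group (sandpile_monoid (S_graph G s (\<lambda>_. 0)) s)"
proof -
  let ?S = "S_graph G s (\<lambda>_. 0)"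
  let ?N = "sandpile_monoid ?S s"
  note carrier = carrier_sandpile_monoid_S_graph_zero[OF assms]
  have "config ?S s c" if "c \<in> Units M" for c
    using that stable_config[of ?S] by (auto simp: carrier_sandpile_monoid simp flip: carrier)
  then have "a \<otimes>\<^bsub>?N\<^esub> b = a \<otimes>\<^bsub>M\<^esub> b" if "a \<in> Units M" "b \<in> Units M" for a b
    using that stabilization_S_graph[OF sandpile_graph assms config_add]
    by (simp add: mult_sandpile_monoid)
  then have "id \<in> hom (units_of M) ?N"
    using M.Units_m_closed by (auto simp: hom_def units_of_def carrier)
  then have "group (?N\<lparr>carrier := Units M, one := \<one>\<^bsub>M\<^esub>\<rparr>)"
    using group.hom_imp_img_group[OF M.units_group] by (fastforce simp: units_of_def)
  moreover have "?N\<lparr>carrier := Units M, one := \<one>\<^bsub>M\<^esub>\<rparr> = ?N"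
    unfolding carrier[symmetric] by (simp add: sandpile_monoid_def)
  ultimately show ?thesis by simp
qed

end

theorem theorem3p5:
  fixes G :: "('v, 'e) pre_digraph" and s :: 'v
  assumes "sandpile_graph G s" and "out_arcs G s = {}"
  shows "(verts (S_graph G s (\<lambda>_. 0)) = {s} \<longrightarrow>
            maximal_subgroup (sandpile_monoid G s) (\<lambda>_. 0) = {\<lambda>_. 0}) \<and>
         (verts (S_graph G s (\<lambda>_. 0)) \<noteq> {s} \<longrightarrow>
            maximal_subgroup (sandpile_monoid G s) (\<lambda>_. 0) = sandpile_group (S_graph G s (\<lambda>_. 0)) s)"
proof -
  interpret sandpile G s by (rule sandpile.intro) (fact assms(1))
  let ?S = "S_graph G s (\<lambda>_. 0)"
  have "maximal_subgroup M (\<lambda>_. 0) = Units M"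
    using M.maximal_subgroup_one by (simp add: one_sandpile_monoid)
  also have "\<dots> = carrier (sandpile_monoid ?S s)"
    using carrier_sandpile_monoid_S_graph_zero[OF assms(2)] ..
  finally have maximal: "maximal_subgroup M (\<lambda>_. 0) = carrier (sandpile_monoid ?S s)" .
  have "sandpile_group ?S s = carrier (sandpile_monoid ?S s)"
    unfolding sandpile_group_def
    using group_sandpile_monoid_S_graph_zero[OF assms(2)] by (rule group.minimal_ideal_eq_carrier)
  then show ?thesis
    using maximal carrier_sandpile_monoid_only_sink[of ?S s] by simp
qed

end
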